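(* Let $\lambda\in\mathbb{R}$, let $\alpha$ be a positive integer, let $m\in\mathbb{N}$ with $m\ge\alpha$, and let $x\in\mathbb{C}$ with $x\neq 0,1$. Then \[ \sum_{k=\alpha}^{m}(k)_{\alpha,\lambda}x^{k}=\frac{1}{x-1}\Big\{x^{m+1}H_{\alpha,\lambda}(m+1\,|\,x^{-1})-x^{\alpha}H_{\alpha,\lambda}(\alpha\,|\,x^{-1})\Big\}, \] and moreover \begin{align*} \frac{1}{x-1}\Big\{x^{m+1}H_{\alpha,\lambda}(m+1\,|\,x^{-1})-x^{\alpha}H_{\alpha,\lambda}(\alpha\,|\,x^{-1})\Big\}&=\sum_{k=1}^{m}S_{2,\lambda}(\alpha,k)\,k!\,x^{k}\sum_{l=0}^{m-k}\binom{l+k}{k}x^{l}\\ &\quad-\sum_{k=1}^{\alpha-1}S_{2,\lambda}(\alpha,k)\,k!\,x^{k}\sum_{l=0}^{\alpha-k-1}\binom{l+k}{k}x^{l}. \end{align*}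
   Context: For $\lambda\in\mathbb{R}$, the generalized falling factorial polynomials are $(x)_{0,\lambda}=1$ and $(x)_{n,\lambda}=x(x-\lambda)\cdots(x-(n-1)\lambda)$ for $n\ge1$; the ordinary falling factorial is $(x)_0=1$, $(x)_n=x(x-1)\cdots(x-n+1)$. The degenerate exponential is the formal power series $e_{\lambda}^{y}(t)=\sum_{n=0}^{\infty}(y)_{n,\lambda}\frac{t^{n}}{n!}$, and $e_\lambda(t)=e_\lambda^1(t)$. For $u\in\mathbb{C}$, $u\ne1$, the degenerate Frobenius–Euler polynomials $H_{n,\lambda}(y\,|\,u)$ are defined by $\frac{1-u}{e_{\lambda}(t)-u}e_{\lambda}^{y}(t)=\sum_{n=0}^{\infty}H_{n,\lambda}(y\,|\,u)\frac{t^{n}}{n!}$. The degenerate Stirling numbers of the second kind $S_{2,\lambda}(n,k)$ are defined by $(y)_{n,\lambda}=\sum_{k=0}^{n}S_{2,\lambda}(n,k)(y)_{k}$ for all $n\ge0$, with $S_{2,\lambda}(n,k)=0$ for $k>n$ or $k<0$. *)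

theory Defs
  imports "HOL-Computational_Algebra.Formal_Power_Series" Complex_Main
begin

definition falling :: "'a::real_field \<Rightarrow> nat \<Rightarrow> 'a" where
  "falling x n = (\<Prod>i<n. x - of_nat i)"

definition gen_falling :: "real \<Rightarrow> 'a::real_field \<Rightarrow> nat \<Rightarrow> 'a" where
  "gen_falling lam x n = (\<Prod>i<n. x - of_nat i * of_real lam)"

definition deg_exp :: "real \<Rightarrow> complex \<Rightarrow> complex fps" where
  "deg_exp lam y = Abs_fps (\<lambda>n. gen_falling lam y n / fact n)"

text \<open>Division is division of formal power series; for \<open>u \<noteq> 1\<close> the denominator has the
  invertible constant term \<open>1 - u\<close>, so this is the genuine quotient
  (see \<open>frobenius_euler_gf\<close> and \<open>frobenius_euler_gf_mult\<close>).\<close>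

definition deg_frobenius_euler :: "nat \<Rightarrow> real \<Rightarrow> complex \<Rightarrow> complex \<Rightarrow> complex" where
  "deg_frobenius_euler n lam y u =
     fact n * fps_nth (fps_const (1 - u) / (deg_exp lam 1 - fps_const u) * deg_exp lam y) n"

lemma frobenius_euler_gf:
  "fps_const (1 - u) / (deg_exp lam 1 - fps_const u) * deg_exp lam y =
     Abs_fps (\<lambda>n. deg_frobenius_euler n lam y u / fact n)"
  by (simp add: fps_eq_iff deg_frobenius_euler_def)

lemma frobenius_euler_gf_mult:
  assumes "u \<noteq> 1"
  shows "(deg_exp lam 1 - fps_const u) * Abs_fps (\<lambda>n. deg_frobenius_euler n lam y u / fact n) =
     fps_const (1 - u) * deg_exp lam y"
proof -
  have 0: "fps_nth (deg_exp lam 1 - fps_const u) 0 \<noteq> 0"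
    using assms by (simp add: deg_exp_def gen_falling_def)
  have "(deg_exp lam 1 - fps_const u) * (fps_const (1 - u) / (deg_exp lam 1 - fps_const u)) =
      fps_const (1 - u)"
    using inverse_mult_eq_1'[OF 0] by (simp add: fps_divide_unit[OF 0] mult.left_commute)
  then show ?thesis
    by (simp flip: frobenius_euler_gf add: mult.assoc[symmetric])
qed

definition is_deg_stirling2 :: "real \<Rightarrow> (nat \<Rightarrow> nat \<Rightarrow> real) \<Rightarrow> bool" where
  "is_deg_stirling2 lam S \<longleftrightarrow>
     (\<forall>n. \<forall>y::real. gen_falling lam y n = (\<Sum>k\<le>n. S n k * falling y k)) \<and>
     (\<forall>n k. k > n \<longrightarrow> S n k = 0)"

definition deg_stirling2 :: "real \<Rightarrow> nat \<Rightarrow> nat \<Rightarrow> real" where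
  "deg_stirling2 lam = (THE S. is_deg_stirling2 lam S)"

lemma falling_of_nat_eq_0: "j < k \<Longrightarrow> falling (of_nat j :: real) k = 0"
  unfolding falling_def by (rule prod_zero) auto

lemma falling_of_nat_self_neq_0: "falling (of_nat j :: real) j \<noteq> 0"
  unfolding falling_def by auto

lemma falling_coeffs_eq_0:
  assumes "\<And>y::real. (\<Sum>k\<le>n. c k * falling y k) = 0"
  shows "j \<le> n \<Longrightarrow> c j = 0"
proof (induction j rule: less_induct)
  case (less j)
  have "0 = (\<Sum>k\<le>n. c k * falling (of_nat j :: real) k)"
    using assms by simp
  also have "\<dots> = (\<Sum>k\<in>{j}. c k * falling (of_nat j :: real) k)"
  proof (rule sum.mono_neutral_right)
    show "\<forall>i\<in>{..n} - {j}. c i * falling (of_nat j :: real) i = 0"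
    proof
      fix i assume "i \<in> {..n} - {j}"
      then show "c i * falling (of_nat j :: real) i = 0"
        using less.IH[of i] falling_of_nat_eq_0[of j i] by (cases "i < j") auto
    qed
  qed (use less.prems in auto)
  finally show ?case
    using falling_of_nat_self_neq_0[of j] by simp
qed

lemma is_deg_stirling2_unique:
  assumes "is_deg_stirling2 lam S" "is_deg_stirling2 lam T"
  shows "S = T"
proof (intro ext)
  fix n k
  have "(\<Sum>k\<le>n. (S n k - T n k) * falling y k) = 0" for y :: real
    using assms by (simp add: is_deg_stirling2_def left_diff_distrib sum_subtractf)
  then have "S n k - T n k = 0" if "k \<le> n"
    using falling_coeffs_eq_0[where n = n and c = "\<lambda>k. S n k - T n k"] that by blast
  then show "S n k = T n k"
    using assms by (cases "k \<le> n") (auto simp: is_deg_stirling2_def)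
qed

primrec deg_stirling2_rec :: "real \<Rightarrow> nat \<Rightarrow> nat \<Rightarrow> real" where
  "deg_stirling2_rec lam 0 = (\<lambda>k. if k = 0 then 1 else 0)"
| "deg_stirling2_rec lam (Suc n) = (\<lambda>k. (if k = 0 then 0 else deg_stirling2_rec lam n (k - 1)) +
     (of_nat k - of_nat n * lam) * deg_stirling2_rec lam n k)"

lemma deg_stirling2_rec_eq_0: "n < k \<Longrightarrow> deg_stirling2_rec lam n k = 0"
  by (induction n arbitrary: k) auto

lemma deg_stirling2_rec_expansion:
  "gen_falling lam y n = (\<Sum>k\<le>n. deg_stirling2_rec lam n k * falling y k)" for y :: real
proof (induction n)
  case 0
  show ?case by (simp add: gen_falling_def falling_def)
next
  case (Suc n)
  let ?S = "deg_stirling2_rec lam n"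
  have "gen_falling lam y (Suc n) = (y - of_nat n * lam) * (\<Sum>k\<le>n. ?S k * falling y k)"
    by (simp flip: Suc.IH add: gen_falling_def)
  also have "\<dots> = (\<Sum>k\<le>n. ?S k * falling y (Suc k)) +
      (\<Sum>k\<le>n. (of_nat k - of_nat n * lam) * ?S k * falling y k)"
    unfolding sum_distrib_left sum.distrib[symmetric]
    by (rule sum.cong) (auto simp: falling_def algebra_simps)
  also have "(\<Sum>k\<le>n. ?S k * falling y (Suc k)) =
      (\<Sum>k\<le>Suc n. (if k = 0 then 0 else ?S (k - 1)) * falling y k)"
    by (subst sum.atMost_Suc_shift) simp
  also have "(\<Sum>k\<le>n. (of_nat k - of_nat n * lam) * ?S k * falling y k) =
      (\<Sum>k\<le>Suc n. (of_nat k - of_nat n * lam) * ?S k * falling y k)"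
    by (simp add: deg_stirling2_rec_eq_0)
  finally show ?case
    unfolding sum.distrib[symmetric] deg_stirling2_rec.simps distrib_right .
qed

lemma is_deg_stirling2_deg_stirling2: "is_deg_stirling2 lam (deg_stirling2 lam)"
proof -
  have "is_deg_stirling2 lam (deg_stirling2_rec lam)"
    using deg_stirling2_rec_expansion deg_stirling2_rec_eq_0
    by (simp add: is_deg_stirling2_def)
  then show ?thesis
    unfolding deg_stirling2_def
    by (metis is_deg_stirling2_unique theI[where P = "is_deg_stirling2 lam"])
qed

end

theory Submission
  imports Defs
begin

text \<open>Since \<open>e\<^sub>\<lambda>\<^sup>y\<close> is the solution of \<open>(1 + \<lambda>t) f' = y f\<close> with \<open>f(0) = 1\<close>, it is multiplicative
  in \<open>y\<close>. Hence \<open>H(y + 1 | u) - u H(y | u) = (1 - u) (y)\<^bsub>\<alpha>,\<lambda>\<^esub>\<close>, and for \<open>u = 1/x\<close> the first identity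
  is a telescoping sum. For the second, \<open>(j)\<^bsub>\<alpha>,\<lambda>\<^esub> = \<Sum>\<^sub>k S(\<alpha>,k) k! (j choose k)\<close>; the sums over
  \<open>j \<le> m\<close> and over \<open>j \<le> \<alpha> - 1\<close> are exchanged with the sum over \<open>k\<close> and subtracted.\<close>

unbundle fps_syntax

text \<open>Comparing coefficients turns the differential equation into a first-order recurrence.
  Read one way it verifies the equation for \<open>deg_exp\<close>; read the other way it shows that
  the constant term determines the solution.\<close>

lemma deg_exp_ode_iff_coeffs:
  "(1 + fps_const (of_real lam) * fps_X) * fps_deriv f = fps_const y * f \<longleftrightarrow>
    (\<forall>n. of_nat (Suc n) * f $ Suc n = (y - of_nat n * of_real lam) * f $ n)"
  for f :: "complex fps"
proof -
  have "((1 + fps_const (of_real lam) * fps_X) * fps_deriv f) $ n =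
      of_nat (Suc n) * f $ Suc n + of_real lam * (of_nat n * f $ n)" for n
    by (cases n) (simp_all add: distrib_right mult.assoc)
  then have "((1 + fps_const (of_real lam) * fps_X) * fps_deriv f) $ n = (fps_const y * f) $ n \<longleftrightarrow>
      of_nat (Suc n) * f $ Suc n = (y - of_nat n * of_real lam) * f $ n" for n
    by (simp add: algebra_simps del: of_nat_Suc)
  then show ?thesis
    unfolding fps_eq_iff by blast
qed

lemma deg_exp_nth_Suc:
  "of_nat (Suc n) * deg_exp lam y $ Suc n = (y - of_nat n * of_real lam) * deg_exp lam y $ n"
proof -
  have "(of_nat (Suc n) :: complex) \<noteq> 0"
    by (rule of_nat_neq_0)
  then show ?thesis
    by (simp add: deg_exp_def gen_falling_def fact_Suc mult.commute del: of_nat_Suc)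
qed

lemma deg_exp_ode:
  "(1 + fps_const (of_real lam) * fps_X) * fps_deriv (deg_exp lam y) = fps_const y * deg_exp lam y"
  unfolding deg_exp_ode_iff_coeffs using deg_exp_nth_Suc by blast

lemma deg_exp_ode_unique:
  assumes ode: "(1 + fps_const (of_real lam) * fps_X) * fps_deriv f = fps_const y * f"
    and init: "f $ 0 = 1"
  shows "f = deg_exp lam y"
proof (rule fps_ext)
  fix n
  show "f $ n = deg_exp lam y $ n"
  proof (induction n)
    case 0
    then show ?case using init by (simp add: deg_exp_def gen_falling_def)
  next
    case (Suc n)
    have "of_nat (Suc n) * f $ Suc n = of_nat (Suc n) * deg_exp lam y $ Suc n"
      using ode[unfolded deg_exp_ode_iff_coeffs] Suc.IH deg_exp_nth_Suc[of n lam y] by metis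
    then show ?case
      by (simp del: of_nat_Suc)
  qed
qed

text \<open>By the product rule the product solves the equation with parameter \<open>y + z\<close>,
  and its constant term is 1, so uniqueness applies.\<close>

lemma deg_exp_add: "deg_exp lam (y + z) = deg_exp lam y * deg_exp lam z"
proof (rule deg_exp_ode_unique[symmetric])
  let ?D = "1 + fps_const (of_real lam) * fps_X :: complex fps"
  have "?D * fps_deriv (deg_exp lam y * deg_exp lam z) =
      (?D * fps_deriv (deg_exp lam y)) * deg_exp lam z
        + deg_exp lam y * (?D * fps_deriv (deg_exp lam z))"
    unfolding fps_deriv_mult by (simp only: algebra_simps)
  also have "\<dots> = fps_const (y + z) * (deg_exp lam y * deg_exp lam z)"
    unfolding deg_exp_ode fps_const_add[symmetric] by (simp only: algebra_simps)
  finally show "?D * fps_deriv (deg_exp lam y * deg_exp lam z) =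
      fps_const (y + z) * (deg_exp lam y * deg_exp lam z)" .
qed (simp add: deg_exp_def gen_falling_def)

text \<open>Multiplying the generating function by its denominator leaves \<open>(1 - u)\<close>
  times \<open>deg_exp lam y\<close>, while the factor \<open>deg_exp lam 1\<close> shifts
  \<open>y\<close> to \<open>y + 1\<close>.\<close>

lemma deg_frobenius_euler_step:
  assumes "u \<noteq> 1"
  shows "deg_frobenius_euler n lam (y + 1) u - u * deg_frobenius_euler n lam y u
      = (1 - u) * gen_falling lam y n"
proof -
  let ?E = "deg_exp lam 1 - fps_const u"
  let ?Q = "fps_const (1 - u) / ?E"
  have 0: "?E $ 0 \<noteq> 0"
    using assms by (simp add: deg_exp_def gen_falling_def)
  have "?E * ?Q = fps_const (1 - u)"
    using inverse_mult_eq_1'[OF 0] by (simp add: fps_divide_unit[OF 0] mult.left_commute)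
  \<comment> \<open>Naming the quotient hides the division; the algebra below needs only the
    relation \<open>?E * Q = fps_const (1 - u)\<close>.\<close>
  then obtain Q where Q: "Q = ?Q" "?E * Q = fps_const (1 - u)"
    by blast
  have "Q * deg_exp lam (y + 1) - fps_const u * (Q * deg_exp lam y) = (?E * Q) * deg_exp lam y"
    unfolding deg_exp_add by (simp only: algebra_simps)
  also have "\<dots> = fps_const (1 - u) * deg_exp lam y"
    by (simp only: Q(2))
  finally have "(Q * deg_exp lam (y + 1)) $ n - u * (Q * deg_exp lam y) $ n
      = (1 - u) * deg_exp lam y $ n"
    by (metis fps_mult_left_const_nth fps_sub_nth)
  then have "fact n * (Q * deg_exp lam (y + 1)) $ n - u * (fact n * (Q * deg_exp lam y) $ n)
      = (1 - u) * (fact n * deg_exp lam y $ n)"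
    by (metis mult.left_commute right_diff_distrib)
  then show ?thesis
    by (simp add: deg_frobenius_euler_def flip: Q(1)) (simp add: deg_exp_def)
qed

lemma sum_gen_falling_power_eq_frobenius_euler:
  assumes "x \<noteq> 0" "x \<noteq> 1" "a \<le> Suc m"
  shows "(\<Sum>k=a..m. gen_falling lam (of_nat k) n * x ^ k) =
    1 / (x - 1) * (x ^ (m + 1) * deg_frobenius_euler n lam (of_nat (m + 1)) (inverse x)
      - x ^ a * deg_frobenius_euler n lam (of_nat a) (inverse x))"
proof -
  \<comment> \<open>The weight \<open>x ^ k\<close> absorbs the factor \<open>u = inverse x\<close>
    of the step relation, which makes its left side a plain difference of consecutive
    values.\<close>
  define h where "h k = x ^ k * deg_frobenius_euler n lam (of_nat k) (inverse x)" for k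
  have "inverse x \<noteq> 1" using assms by simp
  have step: "h (Suc k) - h k = (x - 1) * (gen_falling lam (of_nat k) n * x ^ k)" for k
  proof -
    have "h (Suc k) - h k = x ^ Suc k * (deg_frobenius_euler n lam (of_nat k + 1) (inverse x)
        - inverse x * deg_frobenius_euler n lam (of_nat k) (inverse x))"
      using assms by (simp add: h_def algebra_simps)
    also have "\<dots> = x ^ Suc k * ((1 - inverse x) * gen_falling lam (of_nat k) n)"
      using deg_frobenius_euler_step[OF \<open>inverse x \<noteq> 1\<close>] by simp
    also have "\<dots> = (x - 1) * (gen_falling lam (of_nat k) n * x ^ k)"
      using assms by (simp add: field_simps)
    finally show ?thesis .
  qed
  have "(x - 1) * (\<Sum>k=a..m. gen_falling lam (of_nat k) n * x ^ k) = (\<Sum>k=a..m. h (Suc k) - h k)"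
    by (simp add: step sum_distrib_left)
  also have "\<dots> = h (m + 1) - h a"
    using assms by (simp add: sum_Suc_diff)
  finally show ?thesis
    using assms by (simp add: h_def field_simps)
qed

lemma falling_of_nat: "falling (of_nat j) k = fact k * of_nat (j choose k)"
  by (simp add: falling_def binomial_gbinomial gbinomial_prod_rev atLeast0LessThan)

text \<open>At \<open>y = 0\<close> every falling factorial with \<open>k > 0\<close> vanishes, and
  so does the left side as \<open>n \<ge> 1\<close>. This lets the sums over \<open>k\<close> start
  at 1.\<close>

lemma deg_stirling2_0_right:
  assumes "n \<ge> 1"
  shows "deg_stirling2 lam n 0 = 0"
proof -
  have "gen_falling lam (0::real) n = (\<Sum>k\<le>n. deg_stirling2 lam n k * falling 0 k)"
    using is_deg_stirling2_deg_stirling2 unfolding is_deg_stirling2_def by blast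
  moreover have "gen_falling lam (0::real) n = 0"
    using assms by (auto simp: gen_falling_def intro!: prod_zero bexI[of _ 0])
  moreover have "(\<Sum>k\<le>n. deg_stirling2 lam n k * falling 0 k)
      = (\<Sum>k\<in>{0}. deg_stirling2 lam n k * falling 0 k)"
    using falling_of_nat_eq_0[of 0] by (intro sum.mono_neutral_right) auto
  ultimately show ?thesis by (simp add: falling_def)
qed

text \<open>Terms with \<open>k > n\<close> or \<open>k > j\<close> vanish, so any bound
  \<open>M \<ge> j\<close> may replace \<open>n\<close>, even one below \<open>n\<close>. A bound
  independent of \<open>j\<close> is what allows the later exchange of sums.\<close>

lemma gen_falling_of_nat_eq_sum_binomial:
  assumes "n \<ge> 1" "j \<le> M"
  shows "gen_falling lam (of_nat j :: complex) n =
    (\<Sum>k=1..M. of_real (deg_stirling2 lam n k) * fact k * of_nat (j choose k))"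
proof -
  define s where "s k = deg_stirling2 lam n k * fact k * of_nat (j choose k)" for k
  have vanish: "s k = 0" if "k = 0 \<or> n < k \<or> j < k" for k
    using that deg_stirling2_0_right[OF assms(1)] is_deg_stirling2_deg_stirling2[of lam]
    by (auto simp: s_def is_deg_stirling2_def)
  have "gen_falling lam (of_nat j :: real) n = (\<Sum>k\<le>n. s k)"
    using is_deg_stirling2_deg_stirling2[of lam]
    by (simp add: is_deg_stirling2_def falling_of_nat s_def mult.assoc)
  also have "\<dots> = (\<Sum>k=1..M. s k)"
    by (rule sum.mono_neutral_cong) (use assms vanish in \<open>auto simp: not_le Suc_le_eq\<close>)
  \<comment> \<open>The Stirling numbers are defined by a real identity, which is carried over to
    the complex numbers here.\<close>
  finally have "complex_of_real (gen_falling lam (of_nat j) n) = of_real (\<Sum>k=1..M. s k)"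
    by simp
  then show ?thesis by (simp add: gen_falling_def s_def)
qed

text \<open>The terms with \<open>j < k\<close> are zero; the others are reindexed by
  \<open>j = l + k\<close>.\<close>

lemma sum_binomial_power:
  fixes x :: "'a::comm_semiring_1"
  assumes "k \<le> M"
  shows "(\<Sum>j\<le>M. of_nat (j choose k) * x ^ j) =
    x ^ k * (\<Sum>l=0..M - k. of_nat ((l + k) choose k) * x ^ l)"
proof -
  have "(\<Sum>j\<le>M. of_nat (j choose k) * x ^ j) = (\<Sum>j=0+k..(M-k)+k. of_nat (j choose k) * x ^ j)"
    using assms by (intro sum.mono_neutral_right) (auto simp: not_le binomial_eq_0)
  also have "\<dots> = (\<Sum>l=0..M-k. of_nat ((l + k) choose k) * x ^ (l + k))"
    by (rule sum.shift_bounds_cl_nat_ivl)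
  finally show ?thesis by (simp add: sum_distrib_left power_add mult_ac)
qed

lemma sum_gen_falling_power_eq_stirling:
  fixes x :: complex
  assumes "n \<ge> 1"
  shows "(\<Sum>j\<le>M. gen_falling lam (of_nat j) n * x ^ j) =
    (\<Sum>k=1..M. of_real (deg_stirling2 lam n k) * fact k * x ^ k *
      (\<Sum>l=0..M - k. of_nat ((l + k) choose k) * x ^ l))"
proof -
  let ?c = "\<lambda>k. of_real (deg_stirling2 lam n k) * fact k :: complex"
  have "(\<Sum>j\<le>M. gen_falling lam (of_nat j) n * x ^ j) =
      (\<Sum>j\<le>M. \<Sum>k=1..M. ?c k * (of_nat (j choose k) * x ^ j))"
    by (simp add: gen_falling_of_nat_eq_sum_binomial[OF assms, where M = M]
        sum_distrib_right mult.assoc)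
  also have "\<dots> = (\<Sum>k=1..M. ?c k * (\<Sum>j\<le>M. of_nat (j choose k) * x ^ j))"
    by (subst sum.swap) (simp add: sum_distrib_left)
  finally show ?thesis by (simp add: sum_binomial_power mult.assoc)
qed

theorem theorem5:
  fixes lam :: real and \<alpha> m :: nat and x :: complex
  assumes "\<alpha> \<ge> 1" and "m \<ge> \<alpha>" and "x \<noteq> 0" and "x \<noteq> 1"
  shows "(\<Sum>k=\<alpha>..m. gen_falling lam (of_nat k) \<alpha> * x ^ k) =
      1 / (x - 1) * (x ^ (m + 1) * deg_frobenius_euler \<alpha> lam (of_nat (m + 1)) (inverse x)
        - x ^ \<alpha> * deg_frobenius_euler \<alpha> lam (of_nat \<alpha>) (inverse x))
    \<and> 1 / (x - 1) * (x ^ (m + 1) * deg_frobenius_euler \<alpha> lam (of_nat (m + 1)) (inverse x)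
        - x ^ \<alpha> * deg_frobenius_euler \<alpha> lam (of_nat \<alpha>) (inverse x)) =
      (\<Sum>k=1..m. of_real (deg_stirling2 lam \<alpha> k) * fact k * x ^ k *
         (\<Sum>l=0..m - k. of_nat ((l + k) choose k) * x ^ l))
      - (\<Sum>k=1..\<alpha> - 1. of_real (deg_stirling2 lam \<alpha> k) * fact k * x ^ k *
         (\<Sum>l=0..\<alpha> - k - 1. of_nat ((l + k) choose k) * x ^ l))"
proof -
  let ?f = "\<lambda>k. gen_falling lam (of_nat k) \<alpha> * x ^ k"
  have frob: "(\<Sum>k=\<alpha>..m. ?f k) =
      1 / (x - 1) * (x ^ (m + 1) * deg_frobenius_euler \<alpha> lam (of_nat (m + 1)) (inverse x)
        - x ^ \<alpha> * deg_frobenius_euler \<alpha> lam (of_nat \<alpha>) (inverse x))"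
    using assms by (intro sum_gen_falling_power_eq_frobenius_euler) auto
  \<comment> \<open>Since \<open>\<alpha> \<ge> 1\<close>, the truncated \<open>\<alpha> - 1\<close>
    really is the last index before \<open>\<alpha>\<close>.\<close>
  have "{..m} - {..\<alpha> - 1} = {\<alpha>..m}"
    using assms by auto
  then have "(\<Sum>k=\<alpha>..m. ?f k) = (\<Sum>k\<le>m. ?f k) - (\<Sum>k\<le>\<alpha> - 1. ?f k)"
    using assms sum_diff[of "{..m}" "{..\<alpha> - 1}" ?f] by auto
  also have "\<dots> = (\<Sum>k=1..m. of_real (deg_stirling2 lam \<alpha> k) * fact k * x ^ k *
         (\<Sum>l=0..m - k. of_nat ((l + k) choose k) * x ^ l))
      - (\<Sum>k=1..\<alpha> - 1. of_real (deg_stirling2 lam \<alpha> k) * fact k * x ^ k *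
         (\<Sum>l=0..\<alpha> - k - 1. of_nat ((l + k) choose k) * x ^ l))"
    \<comment> \<open>The expansion is used with \<open>M = m\<close> and
      \<open>M = \<alpha> - 1\<close>; the latter gives the inner bound
      \<open>\<alpha> - 1 - k\<close>, still to be reordered.\<close>
    unfolding sum_gen_falling_power_eq_stirling[OF assms(1)] by (simp add: diff_commute)
  finally show ?thesis using frob by simp
qed

end
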